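(* Let $n\ge1$, let $\lambda$ be a partition, and let $p\in\mathcal P_+(\lambda)$ correspond to the rigged configuration $((\mu^{(1)},J^{(1)}),\ldots,(\mu^{(n)},J^{(n)}))$ under the (generalized) Kerov-Kirillov-Reshetikhin bijection. Let $1\le k\le n$, $l\ge1$, and let $u^{k,l}\in B^{k,l}$ be the $k\times l$ tableau whose entries in the $j$-th row are all $j$. Then $u^{k,l}\otimes p$ corresponds under the bijection to the rigged configuration $$((\mu^{(1)},J^{(1)}),\ldots,(\mu^{(k)},\hat J^{(k)}),\ldots,(\mu^{(n)},J^{(n)})),\qquad \hat J^{(k)}_i=J^{(k)}_i+\min(l,\mu^{(k)}_i),$$ i.e. only the riggings of color $k$ are changed.
   Context: **Crystals.** For $1\le k\le n$, $l\ge1$, $B^{k,l}$ is the set of semistandard tableaux of $k\times l$ rectangular shape ($k$ rows, $l$ columns) with letters $1,\ldots,n+1$. The $A_n$ crystal operators $\tilde e_i,\tilde f_i$ ($1\le i\le n$) are defined as follows. On single letters, $\tilde f_i$ sends $i$ to $i+1$ and all other letters to $0$; $\tilde e_i$ sends $i+1$ to $i$ and all others to $0$. On tensor products, $\tilde e_i(b\otimes b')=\tilde e_ib\otimes b'$ if $\varphi_i(b)\ge\varepsilon_i(b')$, else $b\otimes\tilde e_ib'$; $\tilde f_i(b\otimes b')=\tilde f_ib\otimes b'$ if $\varphi_i(b)>\varepsilon_i(b')$, else $b\otimes\tilde f_ib'$ (with $0\otimes b'=b\otimes 0=0$), where $\varepsilon_i,\varphi_i$ are the maximal numbers of times $\tilde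 e_i,\tilde f_i$ can be applied without getting $0$. A tableau with columns $c_1,\ldots,c_l$ (left to right) is identified with $c_l\otimes c_{l-1}\otimes\cdots\otimes c_1$, each column being read from top to bottom as a tensor product of letters. For a sequence $R=((k_1,l_1),\ldots,(k_m,l_m))$ let $\mathcal P_+(R)$ be the set of $p\in B^{k_1,l_1}\otimes\cdots\otimes B^{k_m,l_m}$ with $\tilde e_ip=0$ for $1\le i\le n$. For a partition $\lambda=(\lambda_1,\ldots,\lambda_m)$, $\mathcal P_+(\lambda)=\mathcal P_+((1,\lambda_1),\ldots,(1,\lambda_m))$. **Rigged configurations.** A rigged configuration for $R$ is $((\mu^{(1)},J^{(1)}),\ldots,(\mu^{(n)},J^{(n)}))$ with each $\mu^{(a)}=(\mu^{(a)}_1,\ldots,\mu^{(a)}_{l_a})$ a (possibly empty) partition and $J^{(a)}\in(\mathbb Z_{\ge0})^{l_a}$ such that, with $E^{(a)}_j=\sum_i\min(j,\mu^{(a)}_i)$, $E^{(0)}_j=E^{(n+1)}_j=0$ and vacancy numbers $$p^{(a)}_j=\sum_{i=1}^m\delta_{a,k_i}\min(j,l_i)+E^{(a-1)}_j-2E^{(a)}_j+E^{(a+1)}_j,$$ one has, for every $a$ and $j$, $0\le J^{(a)}_i\le\cdots\le J^{(a)}_{l}\le p^{(a)}_j$ whenever $\{i,\ldots,l\}=\{t\mid\mu^{(a)}_t=j\}$. The pairs $(\mu^{(a)}_i,J^{(a)}_i)$ are the strings of color $a$; a string of length $j$ is singular if its rigging equals $p^{(a)}_j$. Rigged configurations are regarded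 as multisets of strings in each color. Write $\mathrm{RC}(R)$ for the set of these. **(Generalized) KKR bijection $\mathrm{RC}(R)\to\mathcal P_+(R)$.** It is defined recursively on $R$, treating the last factor $(k,l)=(k_m,l_m)$; the empty $R$ gives the empty path. (i) If $l\ge2$: replace the last entry of $R$ by the two entries $(k,l-1),(k,1)$, keeping the same strings and riggings. If the image for the new data is $q\otimes b'\otimes c$ with $b'\in B^{k,l-1}$, $c\in B^{k,1}$, the image for the original data is $q\otimes b$, where $b\in B^{k,l}$ has first column $c$ followed by the columns of $b'$. (ii) If $l=1$, $k\ge2$: replace the last entry by $(k-1,1),(1,1)$ and add, for each $1\le a<k$, one singular string of length $1$ in color $a$ (singular with respect to the new vacancy numbers), keeping all other riggings. If the image for the new data is $q\otimes c'\otimes x$, the image for the original data is $q\otimes c$ where the column $c$ is $c'$ with $x$ added at the bottom. (iii) If $(k,l)=(1,1)$: put $\ell^{(0)}=1$. For $a=1,2,\ldots,n$ successively: if there is a singular string of color $a$ of length $\ge\ell^{(a-1)}$, select one of the smallest such length, denoted $\ell^{(a)}$; otherwise stop and set $r=a$. If the process does not stop for $a\le n$, set $r=n+1$. Delete the last entry $(1,1)$ of $R$, remove one box from each selected string, give each shortened string the rigging making it singular for the new vacancy numbers (strings of length $0$ are discarded), and keep all other riggings. If the image for the new data is $q$, the image for the original data is $q\otimes r$. An element of $\mathcal P_+(R)$ and a rigged configuration in $\mathrm{RC}(R)$ are said to correspond if the latter is mapped to the former. *)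

theory Defs
  imports "HOL-Library.Multiset"
begin

subsection \<open>Crystals of type A\<close>

text \<open>The element 0 of the paper is rendered as \<^const>\<open>None\<close>.\<close>

record 'b crystal =
  crys_e :: "nat \<Rightarrow> 'b \<Rightarrow> 'b option"
  crys_f :: "nat \<Rightarrow> 'b \<Rightarrow> 'b option"

definition max_iter :: "('b \<Rightarrow> 'b option) \<Rightarrow> 'b \<Rightarrow> nat" where
  "max_iter g b = (GREATEST m. ((\<lambda>z. Option.bind z g) ^^ m) (Some b) \<noteq> None)"

definition crys_eps :: "'b crystal \<Rightarrow> nat \<Rightarrow> 'b \<Rightarrow> nat" where
  "crys_eps C i = max_iter (crys_e C i)"

definition crys_phi :: "'b crystal \<Rightarrow> nat \<Rightarrow> 'b \<Rightarrow> nat" where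
  "crys_phi C i = max_iter (crys_f C i)"

definition tensor :: "'b crystal \<Rightarrow> 'c crystal \<Rightarrow> ('b \<times> 'c) crystal" where
  "tensor C D = \<lparr>
     crys_e = (\<lambda>i (b, b'). if crys_phi C i b \<ge> crys_eps D i b'
                 then map_option (\<lambda>x. (x, b')) (crys_e C i b)
                 else map_option (\<lambda>y. (b, y)) (crys_e D i b')),
     crys_f = (\<lambda>i (b, b'). if crys_phi C i b > crys_eps D i b'
                 then map_option (\<lambda>x. (x, b')) (crys_f C i b)
                 else map_option (\<lambda>y. (b, y)) (crys_f D i b')) \<rparr>"

definition letter_crystal :: "nat crystal" where
  "letter_crystal = \<lparr>
     crys_e = (\<lambda>i x. if x = i + 1 then Some i else None),
     crys_f = (\<lambda>i x. if x = i then Some (i + 1) else None) \<rparr>"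

text \<open>The word \<open>[x\<^sub>1, \<dots>, x\<^sub>N]\<close> stands for the tensor product of its letters in this order.
  The tensor product rule is associative; the iterated product is bracketed to the right.\<close>

primrec word_crystal :: "nat \<Rightarrow> nat list crystal" where
  "word_crystal 0 = \<lparr> crys_e = (\<lambda>i w. None), crys_f = (\<lambda>i w. None) \<rparr>"
| "word_crystal (Suc N) = (let T = tensor letter_crystal (word_crystal N) in \<lparr>
     crys_e = (\<lambda>i w. map_option (\<lambda>(x, v). x # v) (crys_e T i (hd w, tl w))),
     crys_f = (\<lambda>i w. map_option (\<lambda>(x, v). x # v) (crys_f T i (hd w, tl w))) \<rparr>)"

text \<open>A tableau is the list of its columns from left to right, each column being listed from
  top to bottom.\<close>

type_synonym tableau = "nat list list"

definition rect_tableaux :: "nat \<Rightarrow> nat \<Rightarrow> nat \<Rightarrow> tableau set" where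
  "rect_tableaux n k l = {t. length t = l \<and>
     (\<forall>c\<in>set t. length c = k \<and> set c \<subseteq> {1..n + 1} \<and> sorted_wrt (<) c) \<and>
     (\<forall>r<k. sorted (map (\<lambda>c. c ! r) t))}"

definition reading_word :: "tableau \<Rightarrow> nat list" where
  "reading_word t = concat (rev t)"

definition hw_tableau :: "nat \<Rightarrow> nat \<Rightarrow> tableau" where
  "hw_tableau k l = replicate l [1..<k + 1]"

type_synonym path = "tableau list"

definition path_word :: "path \<Rightarrow> nat list" where
  "path_word p = concat (map reading_word p)"

definition highest_paths :: "nat \<Rightarrow> (nat \<times> nat) list \<Rightarrow> path set" where
  "highest_paths n R = {p. list_all2 (\<lambda>(k, l) b. b \<in> rect_tableaux n k l) R p \<and>
     (\<forall>i\<in>{1..n}. crys_e (word_crystal (length (path_word p))) i (path_word p) = None)}"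

definition is_partition :: "nat list \<Rightarrow> bool" where
  "is_partition lam \<longleftrightarrow> sorted_wrt (\<ge>) lam \<and> (\<forall>x\<in>set lam. 1 \<le> x)"

definition row_shapes :: "nat list \<Rightarrow> (nat \<times> nat) list" where
  "row_shapes lam = map (\<lambda>x. (1, x)) lam"

subsection \<open>Rigged configurations\<close>

text \<open>For each color, the multiset of strings (length, rigging). Colors outside
  \<open>{1..n}\<close> carry no strings (see \<open>rigged_configs\<close>), so that the quantities
  \<open>E\<close> for the colors \<open>0\<close> and \<open>n + 1\<close> vanish.\<close>

type_synonym config = "nat \<Rightarrow> (nat \<times> int) multiset"

definition lengths :: "config \<Rightarrow> nat \<Rightarrow> nat multiset" where
  "lengths \<nu> a = image_mset fst (\<nu> a)"

definition box_count :: "(nat \<Rightarrow> nat multiset) \<Rightarrow> nat \<Rightarrow> nat \<Rightarrow> int" where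
  "box_count \<mu> a j = (\<Sum>i\<in>#\<mu> a. int (min j i))"

definition vacancy ::
  "(nat \<times> nat) list \<Rightarrow> (nat \<Rightarrow> nat multiset) \<Rightarrow> nat \<Rightarrow> nat \<Rightarrow> int" where
  "vacancy R \<mu> a j = (\<Sum>(k, l)\<leftarrow>R. if a = k then int (min j l) else 0)
     + box_count \<mu> (a - 1) j - 2 * box_count \<mu> a j + box_count \<mu> (a + 1) j"

definition rigged_configs :: "nat \<Rightarrow> (nat \<times> nat) list \<Rightarrow> config set" where
  "rigged_configs n R = {\<nu>. (\<forall>a. a \<notin> {1..n} \<longrightarrow> \<nu> a = {#}) \<and>
     (\<forall>a\<in>{1..n}. \<forall>(j, x)\<in>#\<nu> a. 1 \<le> j \<and> 0 \<le> x \<and> x \<le> vacancy R (lengths \<nu>) a j)}"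

subsection \<open>The Kerov-Kirillov-Reshetikhin map\<close>

definition add_singular ::
  "(nat \<times> nat) list \<Rightarrow> nat \<Rightarrow> config \<Rightarrow> config" where
  "add_singular R' k \<nu> = (let
      new = (\<lambda>a. 1 \<le> a \<and> a < k);
      \<mu>' = (\<lambda>a. if new a then add_mset 1 (lengths \<nu> a) else lengths \<nu> a)
    in (\<lambda>a. if new a then add_mset (1, vacancy R' \<mu>' a 1) (\<nu> a) else \<nu> a))"

definition singular_lengths ::
  "(nat \<times> nat) list \<Rightarrow> config \<Rightarrow> nat \<Rightarrow> nat \<Rightarrow> nat set" where
  "singular_lengths R \<nu> a m = {j. m \<le> j \<and> (j, vacancy R (lengths \<nu>) a j) \<in># \<nu> a}"

text \<open>\<open>ell a\<close> is the length of the string selected in color \<open>a\<close>, for \<open>1 \<le> a < r\<close>; the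
  values at \<open>a \<ge> r\<close> play no role.\<close>

definition selects ::
  "nat \<Rightarrow> (nat \<times> nat) list \<Rightarrow> config \<Rightarrow> (nat \<Rightarrow> nat) \<Rightarrow> nat \<Rightarrow> bool" where
  "selects n R \<nu> ell r \<longleftrightarrow> 1 \<le> r \<and> r \<le> n + 1 \<and> ell 0 = 1 \<and>
     (\<forall>a. 1 \<le> a \<and> a < r \<longrightarrow> singular_lengths R \<nu> a (ell (a - 1)) \<noteq> {} \<and>
        ell a = (LEAST j. j \<in> singular_lengths R \<nu> a (ell (a - 1)))) \<and>
     (r \<le> n \<longrightarrow> singular_lengths R \<nu> r (ell (r - 1)) = {})"

definition nonempty_string :: "nat \<Rightarrow> 'a \<Rightarrow> 'a multiset" where
  "nonempty_string j s = (if j = 0 then {#} else {#s#})"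

text \<open>\<open>R\<close> is the sequence before and \<open>R'\<close> the sequence after deletion of the last entry.\<close>

definition shorten_selected ::
  "(nat \<times> nat) list \<Rightarrow> (nat \<times> nat) list \<Rightarrow> (nat \<Rightarrow> nat) \<Rightarrow> nat \<Rightarrow> config \<Rightarrow> config" where
  "shorten_selected R R' ell r \<nu> = (let
      sel = (\<lambda>a. 1 \<le> a \<and> a < r);
      \<mu>' = (\<lambda>a. if sel a
              then (lengths \<nu> a - {#ell a#}) + nonempty_string (ell a - 1) (ell a - 1)
              else lengths \<nu> a)
    in (\<lambda>a. if sel a
          then (\<nu> a - {#(ell a, vacancy R (lengths \<nu>) a (ell a))#})
             + nonempty_string (ell a - 1) (ell a - 1, vacancy R' \<mu>' a (ell a - 1))
          else \<nu> a))"

text \<open>The graph of the map: \<open>kkr n R \<nu> p\<close> means that \<open>p\<close> is the image of \<open>\<nu>\<close>. The last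
  factor of \<open>R\<close> determines the applicable rule. A single column \<open>c\<close>, seen as an element of
  \<open>B\<^bsup>k,1\<^esup>\<close>, is the tableau \<open>[c]\<close>.\<close>

inductive kkr :: "nat \<Rightarrow> (nat \<times> nat) list \<Rightarrow> config \<Rightarrow> path \<Rightarrow> bool" for n where
  empty: "\<nu> \<in> rigged_configs n [] \<Longrightarrow> kkr n [] \<nu> []"
| split_column: "2 \<le> l \<Longrightarrow> kkr n (R @ [(k, l - 1), (k, 1)]) \<nu> (q @ [b', [c]]) \<Longrightarrow>
    kkr n (R @ [(k, l)]) \<nu> (q @ [c # b'])"
| split_box: "2 \<le> k \<Longrightarrow> R' = R @ [(k - 1, 1), (1, 1)] \<Longrightarrow>
    kkr n R' (add_singular R' k \<nu>) (q @ [[c'], [[x]]]) \<Longrightarrow>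
    kkr n (R @ [(k, 1)]) \<nu> (q @ [[c' @ [x]]])"
| remove_box: "selects n (R @ [(1, 1)]) \<nu> ell r \<Longrightarrow>
    kkr n R (shorten_selected (R @ [(1, 1)]) R ell r \<nu>) q \<Longrightarrow>
    kkr n (R @ [(1, 1)]) \<nu> (q @ [[[r]]])"

definition corresponds :: "nat \<Rightarrow> (nat \<times> nat) list \<Rightarrow> config \<Rightarrow> path \<Rightarrow> bool" where
  "corresponds n R \<nu> p \<longleftrightarrow>
     \<nu> \<in> rigged_configs n R \<and> p \<in> highest_paths n R \<and> kkr n R \<nu> p"

end

theory Submission
  imports Defs
begin

text \<open>Adding \<open>min l j\<close> to the riggings of color \<open>k\<close> compensates exactly the change of the vacancy
  numbers caused by the new first factor \<open>(k, l)\<close>. Hence singular strings stay singular and the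
  algorithm runs in parallel on both sides until only the factor \<open>(k, l)\<close> remains, when the
  configuration must be empty because the numbers of strings form a convex sequence in the color,
  vanishing at \<open>0\<close> and \<open>n + 1\<close>. The empty configuration is mapped to the tableau \<open>u\<close>.
  On the crystal side, being highest is the ballot condition, which \<open>u\<close> satisfies.\<close>

subsection \<open>Highest weight words\<close>

text \<open>A rank that vanishes exactly where \<open>g\<close> is undefined and drops by one at
  each application counts the applications left. The invariant set \<open>S\<close> allows
  restriction to words of a fixed length.\<close>

lemma max_iter_eq_rank:
  assumes "\<And>b. b \<in> S \<Longrightarrow> g b = None \<longleftrightarrow> c b = (0::nat)"
    and "\<And>b b'. b \<in> S \<Longrightarrow> g b = Some b' \<Longrightarrow> b' \<in> S \<and> c b = Suc (c b')"
    and "b \<in> S"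
  shows "max_iter g b = c b"
proof -
  let ?G = "\<lambda>z. Option.bind z g"
  have none: "(?G ^^ m) None = None" for m
    by (induction m) auto
  have "(?G ^^ m) (Some b) \<noteq> None \<longleftrightarrow> m \<le> c b" for m
    using assms(3)
  proof (induction m arbitrary: b)
    case (Suc m)
    show ?case
    proof (cases "g b")
      case None
      then show ?thesis
        using assms(1)[OF Suc.prems] none by (simp add: funpow_Suc_right del: funpow.simps)
    next
      case (Some b')
      then show ?thesis
        using assms(2)[OF Suc.prems Some] Suc.IH[of b']
        by (simp add: funpow_Suc_right del: funpow.simps)
    qed
  qed simp
  then show ?thesis
    unfolding max_iter_def by (simp add: Greatest_equality)
qed

lemma crys_phi_letter: "crys_phi letter_crystal i x = (if x = i then 1 else 0)"
  unfolding crys_phi_def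
  by (rule max_iter_eq_rank[where S = UNIV and c = "\<lambda>x. if x = i then 1 else 0"])
    (auto simp: letter_crystal_def split: if_splits)

lemma crys_e_letter: "crys_e letter_crystal i x = (if x = Suc i then Some i else None)"
  by (simp add: letter_crystal_def)

text \<open>The value of \<open>\<epsilon>\<^sub>i\<close> on a word by the signature rule; the subtraction is meant to be
  truncated.\<close>

primrec word_eps :: "nat \<Rightarrow> nat list \<Rightarrow> nat" where
  "word_eps i [] = 0"
| "word_eps i (x # w) =
    (if x = i then word_eps i w - 1 else if x = Suc i then Suc (word_eps i w) else word_eps i w)"

text \<open>Together the two claims make \<open>word_eps i\<close> a rank, so the induction
  hypothesis yields \<open>\<epsilon>\<^sub>i\<close> of the tail by
  \<open>max_iter_eq_rank\<close>; this value decides on which side the tensor rule acts.\<close>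

lemma crys_e_word_eps:
  assumes "length w = N"
  shows "(crys_e (word_crystal N) i w = None \<longleftrightarrow> word_eps i w = 0) \<and>
    (\<forall>w'. crys_e (word_crystal N) i w = Some w' \<longrightarrow>
      length w' = N \<and> word_eps i w = Suc (word_eps i w'))"
  using assms
proof (induction N arbitrary: w)
  case (Suc N)
  then obtain x v where w: "w = x # v" and v: "length v = N"
    by (cases w) auto
  have eps: "crys_eps (word_crystal N) i v = word_eps i v"
    unfolding crys_eps_def
    by (rule max_iter_eq_rank[where S = "{w. length w = N}"]) (use Suc.IH v in auto)
  show ?case
    using Suc.IH[OF v] v
    by (cases "crys_e (word_crystal N) i v")
      (auto simp: w tensor_def Let_def eps crys_phi_letter crys_e_letter split: if_splits)
qed simp

lemma crys_e_word_eq_None_iff: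
  "crys_e (word_crystal (length w)) i w = None \<longleftrightarrow> word_eps i w = 0"
  using crys_e_word_eps[OF refl] by blast

text \<open>The recursion scans from the right, so a suffix of value 0 starts the scan of the prefix
  at 0.\<close>

lemma word_eps_append: "word_eps i v = 0 \<Longrightarrow> word_eps i (u @ v) = word_eps i u"
  by (induction u) auto

text \<open>Scanned from the right, \<open>Suc i\<close> adds one and the \<open>i\<close> just
  before it cancels this; only an interval starting at \<open>Suc i\<close> lacks that
  \<open>i\<close>.\<close>

lemma word_eps_upt: "word_eps i [a..<b] = (if a = Suc i \<and> a < b then 1 else 0)"
proof (cases "a \<le> b")
  case True
  then show ?thesis
    by (induction rule: inc_induct) (auto simp: upt_conv_Cons simp del: upt_Suc)
qed simp

lemma word_eps_hw_tableau:
  assumes "1 \<le> i"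
  shows "word_eps i (reading_word (hw_tableau k l)) = 0"
proof (induction l)
  case (Suc l)
  have "reading_word (hw_tableau k (Suc l)) = [1..<k + 1] @ reading_word (hw_tableau k l)"
    unfolding reading_word_def hw_tableau_def rev_replicate by (simp del: upt_Suc)
  \<comment> \<open>Columns start at 1, whereas \<open>Suc i\<close> is at least 2.\<close>
  then show ?case
    using Suc assms by (simp add: word_eps_append word_eps_upt del: upt_Suc)
qed (simp add: reading_word_def hw_tableau_def)

lemma hw_tableau_in_rect_tableaux: "k \<le> n \<Longrightarrow> hw_tableau k l \<in> rect_tableaux n k l"
  by (auto simp: hw_tableau_def rect_tableaux_def simp del: upt_Suc)

lemma hw_tableau_Cons_highest_paths:
  assumes "k \<le> n" and "p \<in> highest_paths n R"
  shows "hw_tableau k l # p \<in> highest_paths n ((k, l) # R)"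
proof -
  have "word_eps i (path_word (hw_tableau k l # p)) = 0" if "i \<in> {1..n}" for i
    using assms(2) that
    by (simp add: highest_paths_def crys_e_word_eq_None_iff path_word_def word_eps_append
        word_eps_hw_tableau)
  then show ?thesis
    using assms hw_tableau_in_rect_tableaux by (simp add: highest_paths_def crys_e_word_eq_None_iff)
qed

subsection \<open>The empty configuration\<close>

text \<open>\<open>box_count \<mu> a 1\<close> is the number of nonzero parts, and each of them
  contributes at most \<open>j\<close>.\<close>

lemma box_count_le_mult: "box_count \<mu> a j \<le> int j * box_count \<mu> a 1"
proof -
  have "int (min j i) \<le> int j * int (min 1 i)" for i
    by (cases i) auto
  then show ?thesis
    by (simp add: box_count_def sum_mset_distrib_left sum_mset_mono)
qed

text \<open>The equality case of the preceding bound, attained when \<open>j\<close> is the shortest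
  length.\<close>

lemma box_count_eq_mult:
  assumes "\<And>i. i \<in># \<mu> a \<Longrightarrow> 1 \<le> j \<and> j \<le> i"
  shows "box_count \<mu> a j = int j * box_count \<mu> a 1"
proof -
  have "image_mset (\<lambda>i. int (min j i)) (\<mu> a) = image_mset (\<lambda>i. int j * int (min 1 i)) (\<mu> a)"
    by (rule image_mset_cong) (use assms in force)
  then show ?thesis
    by (simp add: box_count_def sum_mset_distrib_left)
qed

text \<open>Discrete maximum principle: at the leftmost point of a positive maximum the left
  neighbour is strictly smaller, against convexity.\<close>

lemma convex_nonpos:
  fixes f :: "nat \<Rightarrow> int"
  assumes "f 0 = 0" and "f (Suc n) = 0"
    and "\<And>a. 1 \<le> a \<Longrightarrow> a \<le> n \<Longrightarrow> 2 * f a \<le> f (a - 1) + f (a + 1)"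
    and "a \<le> Suc n"
  shows "f a \<le> 0"
proof (rule ccontr)
  assume pos: "\<not> f a \<le> 0"
  let ?M = "Max (f ` {..Suc n})"
  let ?b = "LEAST b. b \<le> Suc n \<and> f b = ?M"
  have "?M \<in> f ` {..Suc n}"
    by (rule Max_in) auto
  then have ex: "\<exists>b. b \<le> Suc n \<and> f b = ?M"
    by force
  have b: "?b \<le> Suc n" "f ?b = ?M"
    using LeastI_ex[OF ex] by auto
  have le: "f c \<le> ?M" if "c \<le> Suc n" for c
    using that by simp
  have "?M > 0"
    using le[OF assms(4)] pos by linarith
  then have "?b \<noteq> 0" "?b \<noteq> Suc n"
    using b assms(1,2) by (metis less_irrefl)+
  with b(1) have bn: "1 \<le> ?b" "?b \<le> n"
    by linarith+
  have "f (?b - 1) \<noteq> ?M"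
    using not_less_Least[of "?b - 1" "\<lambda>b. b \<le> Suc n \<and> f b = ?M"] bn by auto
  moreover have "f (?b - 1) \<le> ?M" "f (?b + 1) \<le> ?M"
    using bn by (auto intro!: le)
  ultimately show False
    using assms(3)[OF bn] b(2) by linarith
qed

lemma rigged_configs_Nil:
  assumes "\<nu> \<in> rigged_configs n []"
  shows "\<nu> = (\<lambda>_. {#})"
proof
  fix a
  let ?f = "\<lambda>a. box_count (lengths \<nu>) a 1"
  have out: "\<nu> b = {#}" if "b \<notin> {1..n}" for b
    using assms that by (auto simp: rigged_configs_def)
  have str: "1 \<le> j \<and> 0 \<le> vacancy [] (lengths \<nu>) b j" if "j \<in># lengths \<nu> b" for b j
  proof -
    from that obtain x where "(j, x) \<in># \<nu> b"
      by (auto simp: lengths_def)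
    moreover from this have "b \<in> {1..n}"
      using out by fastforce
    ultimately show ?thesis
      using assms by (fastforce simp: rigged_configs_def)
  qed
  have nonneg: "0 \<le> ?f b" for b
    using sum_mset_mono[of "lengths \<nu> b" "\<lambda>_. 0" "\<lambda>i. int (min 1 i)"] by (simp add: box_count_def)
  have zero: "?f b = 0" if "b \<notin> {1..n}" for b
    using out[OF that] by (simp add: box_count_def lengths_def)
  have "2 * ?f b \<le> ?f (b - 1) + ?f (b + 1)" for b
  proof (cases "lengths \<nu> b = {#}")
    case True
    then have "?f b = 0"
      by (simp add: box_count_def)
    then show ?thesis
      using nonneg[of "b - 1"] nonneg[of "b + 1"] by linarith
  next
    case False
    \<comment> \<open>At the shortest length the count of color \<open>b\<close> is exactly
      \<open>?s\<close> times its number of strings, while the neighbours have at most that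
      multiple; cancelling \<open>?s\<close> leaves convexity.\<close>
    let ?s = "Min_mset (lengths \<nu> b)"
    have s: "?s \<in># lengths \<nu> b"
      using False by simp
    have "box_count (lengths \<nu>) b ?s = int ?s * ?f b"
      by (rule box_count_eq_mult) (use s str in auto)
    moreover have "0 \<le> vacancy [] (lengths \<nu>) b ?s"
      using str[OF s] by blast
    ultimately have "2 * (int ?s * ?f b)
        \<le> box_count (lengths \<nu>) (b - 1) ?s + box_count (lengths \<nu>) (b + 1) ?s"
      by (simp add: vacancy_def)
    also have "\<dots> \<le> int ?s * ?f (b - 1) + int ?s * ?f (b + 1)"
      by (intro add_mono box_count_le_mult)
    finally have "int ?s * (2 * ?f b) \<le> int ?s * (?f (b - 1) + ?f (b + 1))"
      by (simp add: algebra_simps)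
    then show ?thesis
      using str[OF s] by (subst (asm) mult_le_cancel_left_pos) auto
  qed
  then have "?f a \<le> 0"
    using zero convex_nonpos[of ?f n a] by (cases "a \<le> Suc n") auto
  then have "?f a = 0"
    using nonneg[of a] by linarith
  \<comment> \<open>Over the naturals a vanishing sum forces every summand to vanish.\<close>
  moreover have "?f a = int (\<Sum>i\<in>#lengths \<nu> a. min 1 i)"
    by (simp add: box_count_def multiset.map_comp o_def)
  ultimately have "\<forall>j\<in>#lengths \<nu> a. min 1 j = 0"
    by (simp del: of_nat_sum_mset)
  then have "\<forall>j\<in>#lengths \<nu> a. j = 0"
    by (auto simp: min_def split: if_splits)
  then have "lengths \<nu> a = {#}"
    using str by (metis multiset_nonemptyE not_one_le_zero)
  then show "\<nu> a = {#}"
    by (simp add: lengths_def)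
qed

text \<open>The lengths used inside \<open>add_singular\<close> are those of its own result, so the
  added strings are visibly singular there.\<close>

lemma add_singular_eq:
  "add_singular R k \<nu> = (\<lambda>a. if 1 \<le> a \<and> a < k
    then add_mset (1, vacancy R (lengths (add_singular R k \<nu>)) a 1) (\<nu> a) else \<nu> a)"
proof -
  have len: "lengths (add_singular R k \<nu>) =
      (\<lambda>a. if 1 \<le> a \<and> a < k then add_mset 1 (lengths \<nu> a) else lengths \<nu> a)"
    by (auto simp: add_singular_def lengths_def)
  show ?thesis
    unfolding len by (simp only: add_singular_def Let_def)
qed

text \<open>Splitting off the bottom box of a column of height \<open>Suc j\<close> adds singular
  strings of length 1 in colors 1 to \<open>j\<close>. Removing the box selects them all, stops at
  color \<open>Suc j\<close> and restores the empty configuration. General \<open>R\<close> and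
  \<open>q\<close> serve the induction on the width.\<close>

lemma kkr_empty_config_column:
  assumes "kkr n R (\<lambda>_. {#}) q" and "1 \<le> j" and "j \<le> n"
  shows "kkr n (R @ [(j, 1)]) (\<lambda>_. {#}) (q @ [[[1..<j + 1]]])"
  using assms(2,3)
proof (induction j rule: nat_induct_at_least)
  case base
  have "selects n (R @ [(1, 1)]) (\<lambda>_. {#}) (\<lambda>_. 1) 1"
    by (use base in \<open>auto simp: selects_def singular_lengths_def\<close>)
  moreover have "shorten_selected (R @ [(1, 1)]) R (\<lambda>_. 1) 1 (\<lambda>_. {#}) = (\<lambda>_. {#})"
    by (auto simp: shorten_selected_def)
  ultimately show ?case
    using remove_box assms(1) by fastforce
next
  case (Suc j)
  define R' where "R' = R @ [(j, 1), (1, 1)]"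
  define \<nu> where "\<nu> = add_singular R' (Suc j) (\<lambda>_. {#})"
  \<comment> \<open>Only singularity matters, so the vacancy numbers stay unevaluated.\<close>
  define V where "V a = vacancy R' (lengths \<nu>) a 1" for a
  have nu: "\<nu> a = (if 1 \<le> a \<and> a < Suc j then {#(1, V a)#} else {#})" for a
    unfolding V_def \<nu>_def by (subst add_singular_eq) simp
  have sing: "singular_lengths R' \<nu> a 1 = (if 1 \<le> a \<and> a < Suc j then {1} else {})" for a
    by (auto simp: singular_lengths_def nu V_def)
  have sel: "selects n R' \<nu> (\<lambda>_. 1) (Suc j)"
    unfolding selects_def sing using Suc.prems by (auto simp: Least_equality)
  have short: "shorten_selected R' (R @ [(j, 1)]) (\<lambda>_. 1) (Suc j) \<nu> = (\<lambda>_. {#})"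
    by (auto simp: shorten_selected_def nonempty_string_def nu V_def)
  have R': "R' = (R @ [(j, 1)]) @ [(1, 1)]"
    by (simp add: R'_def)
  have "kkr n (R @ [(j, 1)]) (\<lambda>_. {#}) (q @ [[[1..<j + 1]]])"
    using Suc by simp
  then have "kkr n R' \<nu> ((q @ [[[1..<j + 1]]]) @ [[[Suc j]]])"
    using sel short unfolding R' by (intro remove_box[where ell = "\<lambda>_. 1"]) simp_all
  then have "kkr n (R @ [(Suc j, 1)]) (\<lambda>_. {#}) (q @ [[[1..<j + 1] @ [Suc j]]])"
    using Suc.hyps by (intro split_box[where R' = R']) (simp_all add: \<nu>_def R'_def)
  then show ?case
    by simp
qed

lemma kkr_empty_config_rectangle:
  assumes "1 \<le> k" and "k \<le> n" and "1 \<le> l"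
  shows "kkr n [(k, l)] (\<lambda>_. {#}) [hw_tableau k l]"
  using assms(3)
proof (induction l rule: nat_induct_at_least)
  case base
  have "kkr n [] (\<lambda>_. {#}) []"
    by (rule kkr.empty) (simp add: rigged_configs_def)
  then show ?case
    using kkr_empty_config_column assms by (force simp: hw_tableau_def)
next
  case (Suc l)
  have "kkr n ([(k, l)] @ [(k, 1)]) (\<lambda>_. {#}) ([hw_tableau k l] @ [[[1..<k + 1]]])"
    using kkr_empty_config_column Suc.IH assms by blast
  then have "kkr n ([] @ [(k, Suc l)]) (\<lambda>_. {#}) ([] @ [[1..<k + 1] # hw_tableau k l])"
    using Suc.hyps by (intro split_column) simp_all
  then show ?case
    by (simp add: hw_tableau_def)
qed

subsection \<open>Shifting the riggings of one color\<close>

definition shift_string :: "nat \<Rightarrow> nat \<times> int \<Rightarrow> nat \<times> int" where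
  "shift_string l = (\<lambda>(j, x). (j, x + int (min l j)))"

definition shift_riggings :: "nat \<Rightarrow> nat \<Rightarrow> config \<Rightarrow> config" where
  "shift_riggings k l \<nu> = \<nu>(k := image_mset (shift_string l) (\<nu> k))"

text \<open>Injectivity lets the shift commute with the removal of a string.\<close>

lemma inj_shift_string: "inj (shift_string l)"
  by (auto simp: inj_def shift_string_def)

lemma lengths_shift_riggings [simp]: "lengths (shift_riggings k l \<nu>) = lengths \<nu>"
  by (auto simp: lengths_def shift_riggings_def shift_string_def multiset.map_comp o_def
      case_prod_unfold)

lemma vacancy_Cons:
  "vacancy ((k, l) # R) \<mu> a j = vacancy R \<mu> a j + (if a = k then int (min l j) else 0)"
  by (simp add: vacancy_def min.commute)

text \<open>The added term has the form of the one in \<open>vacancy_Cons\<close>, so that singular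
  strings rewrite to singular strings.\<close>

lemma mem_shift_riggings_iff:
  "(j, x + (if a = k then int (min l j) else 0)) \<in># shift_riggings k l \<nu> a \<longleftrightarrow> (j, x) \<in># \<nu> a"
  by (force simp: shift_riggings_def shift_string_def)

lemma singular_lengths_shift:
  "singular_lengths ((k, l) # R) (shift_riggings k l \<nu>) = singular_lengths R \<nu>"
  by (intro ext)
    (simp add: singular_lengths_def vacancy_Cons mem_shift_riggings_iff)

lemma selects_shift:
  "selects n ((k, l) # R) (shift_riggings k l \<nu>) = selects n R \<nu>"
  by (intro ext) (simp add: selects_def singular_lengths_shift)

text \<open>New strings have length 1, so in color \<open>k\<close> the vacancy number and the
  shifted rigging both grow by \<open>min l 1\<close>, which is 1.\<close>

lemma add_singular_shift:
  assumes "1 \<le> l"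
  shows "add_singular ((k, l) # R) m (shift_riggings k l \<nu>) = shift_riggings k l (add_singular R m \<nu>)"
  using assms unfolding add_singular_def Let_def lengths_shift_riggings
  by (intro ext) (simp add: vacancy_Cons shift_riggings_def shift_string_def)

text \<open>The selected string and its shortened form are both singular, and each is shifted by the
  change of the vacancy number at its own length.\<close>

lemma shorten_selected_shift:
  "shorten_selected ((k, l) # R) ((k, l) # R') ell r (shift_riggings k l \<nu>) =
    shift_riggings k l (shorten_selected R R' ell r \<nu>)"
  unfolding shorten_selected_def Let_def lengths_shift_riggings
  by (intro ext)
    (simp add: vacancy_Cons shift_riggings_def image_mset_diff_if_inj[OF inj_shift_string]
      nonempty_string_def, simp add: shift_string_def)

text \<open>In color \<open>k\<close> each rigging and its upper bound rise by the same nonnegative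
  amount.\<close>

lemma shift_riggings_in_rigged_configs:
  assumes "\<nu> \<in> rigged_configs n R"
  shows "shift_riggings k l \<nu> \<in> rigged_configs n ((k, l) # R)"
proof -
  have "1 \<le> j \<and> 0 \<le> y \<and> y \<le> vacancy ((k, l) # R) (lengths \<nu>) a j"
    if a: "a \<in> {1..n}" and y: "(j, y) \<in># shift_riggings k l \<nu> a" for a j y
  proof -
    from y obtain x where "(j, x) \<in># \<nu> a" and "y = x + (if a = k then int (min l j) else 0)"
      using mem_shift_riggings_iff[of j "y - (if a = k then int (min l j) else 0)" a k l \<nu>] by force
    moreover from this a have "1 \<le> j \<and> 0 \<le> x \<and> x \<le> vacancy R (lengths \<nu>) a j"
      using assms by (auto simp: rigged_configs_def)
    ultimately show ?thesis
      by (simp add: vacancy_Cons)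
  qed
  moreover have "shift_riggings k l \<nu> a = {#}" if "a \<notin> {1..n}" for a
    using assms that by (auto simp: rigged_configs_def shift_riggings_def)
  ultimately show ?thesis
    by (auto simp: rigged_configs_def)
qed

text \<open>Every rule acts at the end of the sequence, so a derivation for \<open>R\<close> can be
  replayed behind an extra first factor.\<close>

lemma kkr_shift:
  assumes "kkr n R \<nu> p" and "1 \<le> k" and "k \<le> n" and "1 \<le> l"
  shows "kkr n ((k, l) # R) (shift_riggings k l \<nu>) (hw_tableau k l # p)"
  using assms(1)
proof induction
  case (empty \<nu>)
  then have "shift_riggings k l \<nu> = (\<lambda>_. {#})"
    by (auto simp: shift_riggings_def dest!: rigged_configs_Nil)
  \<comment> \<open>The given derivation ends here, but the factor \<open>(k, l)\<close> is still to
    be processed.\<close>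
  then show ?case
    using kkr_empty_config_rectangle[OF assms(2-4)] by simp
next
  case (split_column l' R k' \<nu> q b' c)
  then show ?case
    using kkr.split_column[of l' n "(k, l) # R" k' _ "hw_tableau k l # q"] by simp
next
  case (split_box k' R' R \<nu> q c' x)
  then show ?case
    using kkr.split_box[of k' "(k, l) # R'" "(k, l) # R" n _ "hw_tableau k l # q"]
    by (simp add: add_singular_shift[OF assms(4)])
next
  case (remove_box R \<nu> ell r q)
  have "selects n (((k, l) # R) @ [(1, 1)]) (shift_riggings k l \<nu>) ell r"
    using remove_box.hyps(1) by (simp add: selects_shift)
  moreover have "kkr n ((k, l) # R) (shorten_selected (((k, l) # R) @ [(1, 1)]) ((k, l) # R) ell r
      (shift_riggings k l \<nu>)) (hw_tableau k l # q)"
    using remove_box.IH by (simp add: shorten_selected_shift)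
  ultimately have "kkr n (((k, l) # R) @ [(1, 1)]) (shift_riggings k l \<nu>)
      ((hw_tableau k l # q) @ [[[r]]])"
    by (rule kkr.remove_box)
  then show ?case
    by simp
qed

theorem proposition2p6:
  fixes n k l :: nat and lam :: "nat list" and \<nu> :: config and p :: path
  assumes "1 \<le> n"
    and "is_partition lam"
    and "p \<in> highest_paths n (row_shapes lam)"
    and "\<nu> \<in> rigged_configs n (row_shapes lam)"
    and "corresponds n (row_shapes lam) \<nu> p"
    and "1 \<le> k" and "k \<le> n" and "1 \<le> l"
  shows "corresponds n ((k, l) # row_shapes lam)
           (\<nu>(k := image_mset (\<lambda>(j, x). (j, x + int (min l j))) (\<nu> k)))
           (hw_tableau k l # p)"
  using assms shift_riggings_in_rigged_configs[of \<nu> n _ k l] hw_tableau_Cons_highest_paths[of k n p _ l]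
    kkr_shift[of n _ \<nu> p k l]
  by (simp add: corresponds_def shift_riggings_def shift_string_def)

end
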